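(* Let $x \in \mathbb{R}^N_{\geqslant 0}$ satisfy $\mathbf{1}^{\top} x = 1$, where $\mathbf{1}\in\mathbb{R}^N$ is the vector of all ones. Let $A = \mathrm{diag}(x) - xx^\top \in \mathbb{R}^{N\times N}$. Then the singular values $\sigma_1(A)\geqslant \dots \geqslant \sigma_N(A)$ of $A$ satisfy $$x_{(1)} \geqslant g_1(x) \geqslant \sigma_{1}(A) \geqslant x_{(2)} \geqslant g_2(x) \geqslant \sigma_{2}(A) \geqslant \dots \geqslant x_{(N)} \geqslant g_{N}(x) \geqslant \sigma_N(A).$$
   Context: For $x\in\mathbb{R}^N_{\geqslant 0}$, $x_{(k)}$ denotes the $k$-th largest component of $x$ (with multiplicity), so $x_{(1)}\geqslant x_{(2)}\geqslant\dots\geqslant x_{(N)}$. For $k=1,\dots,N-1$ define $g_k(x) := x_{(k)}\,(1 - x_{(k)} + x_{(k+1)})$, and define $g_N(x) := 0$. Here $\mathrm{diag}(x)$ is the diagonal matrix with the entries of $x$ on its diagonal. *)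

theory Defs
  imports "Jordan_Normal_Form.Char_Poly"
begin

text \<open>Positions are counted from 1; the value is meaningful only for \<open>1 \<le> k \<le> size M\<close>.\<close>
definition kth_largest :: "nat \<Rightarrow> 'a::linorder multiset \<Rightarrow> 'a" where
  "kth_largest k M = rev (sorted_list_of_multiset M) ! (k - 1)"

definition ranked_entry :: "real vec \<Rightarrow> nat \<Rightarrow> real" where
  "ranked_entry x k = kth_largest k (mset (list_of_vec x))"

definition g_fun :: "nat \<Rightarrow> real vec \<Rightarrow> real" where
  "g_fun k x = (if k < dim_vec x
                then ranked_entry x k * (1 - ranked_entry x k + ranked_entry x (k + 1))
                else 0)"

definition outer_prod :: "'a::semiring_0 vec \<Rightarrow> 'a vec \<Rightarrow> 'a mat" where
  "outer_prod v w = mat (dim_vec v) (dim_vec w) (\<lambda>(i, j). v $ i * w $ j)"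

text \<open>
  The square roots of the eigenvalues of \<open>A\<^sup>T A\<close>, with algebraic multiplicity. For a wide
  \<open>m \<times> n\<close> matrix this yields \<open>n - m\<close> zeros more than the usual \<open>min m n\<close> values; for square
  matrices there is no discrepancy. That no root of the characteristic polynomial is lost over
  the reals is shown in \<open>size_singular_values\<close> below.
\<close>
definition singular_values :: "real mat \<Rightarrow> real multiset" where
  "singular_values A = image_mset sqrt (proots (char_poly (transpose_mat A * A)))"

definition singular_value :: "real mat \<Rightarrow> nat \<Rightarrow> real" where
  "singular_value A k = kth_largest k (singular_values A)"

lemma char_poly_gram_root:
  fixes A :: "real mat" and z :: complex
  assumes A: "A \<in> carrier_mat m n"
    and z: "poly (char_poly (map_mat complex_of_real (transpose_mat A * A))) z = 0"
  shows "\<exists>r\<ge>0. z = of_real r"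
proof -
  let ?C = "map_mat complex_of_real A"
  have C: "?C \<in> carrier_mat m n" using A by auto
  have Ct: "transpose_mat ?C \<in> carrier_mat n m" using C by auto
  have gram: "map_mat complex_of_real (transpose_mat A * A) = transpose_mat ?C * ?C"
    using A by (subst of_real_hom.mat_hom_mult[of _ n m _ n]) (auto simp: map_mat_transpose)
  have "eigenvalue (transpose_mat ?C * ?C) z"
    using z eigenvalue_root_char_poly[of "transpose_mat ?C * ?C" n z] C Ct gram by auto
  then obtain v where v: "v \<in> carrier_vec n" "v \<noteq> 0\<^sub>v n"
    and ev: "(transpose_mat ?C * ?C) *\<^sub>v v = z \<cdot>\<^sub>v v"
    unfolding eigenvalue_def eigenvector_def using C by auto
  define w where "w = ?C *\<^sub>v v"
  have w: "w \<in> carrier_vec m" using C v unfolding w_def by auto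
  have conj_w: "conjugate w = ?C *\<^sub>v conjugate v"
    by (rule eq_vecI) (use C v in \<open>auto simp: w_def scalar_prod_def row_def\<close>)
  have "z * (v \<bullet> conjugate v) = (z \<cdot>\<^sub>v v) \<bullet> conjugate v"
    using v by auto
  also have "\<dots> = (transpose_mat ?C *\<^sub>v w) \<bullet> conjugate v"
    unfolding ev[symmetric] w_def using C Ct v by (subst assoc_mult_mat_vec) auto
  also have "\<dots> = w \<bullet> (?C *\<^sub>v conjugate v)"
    using transpose_vec_mult_scalar[of "?C" m n "conjugate v" w] C v w by auto
  also have "\<dots> = w \<bullet> conjugate w" by (simp add: conj_w)
  finally have eq: "z * (v \<bullet> conjugate v) = w \<bullet> conjugate w" .
  have "v \<bullet> conjugate v > 0"
    using v conjugate_square_greater_0_vec[of v n] by auto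
  moreover have "w \<bullet> conjugate w \<ge> 0"
    by (rule conjugate_square_ge_0_vec)
  ultimately have "v \<bullet> conjugate v = of_real (Re (v \<bullet> conjugate v))" "Re (v \<bullet> conjugate v) > 0"
    "w \<bullet> conjugate w = of_real (Re (w \<bullet> conjugate w))" "Re (w \<bullet> conjugate w) \<ge> 0"
    by (auto simp: complex_eq_iff less_complex_def less_eq_complex_def)
  then obtain a b where ab: "v \<bullet> conjugate v = of_real a" "w \<bullet> conjugate w = of_real b"
    "a > 0" "b \<ge> 0"
    by metis
  have "z = of_real (b / a)"
    using eq ab by (simp add: field_simps)
  thus ?thesis using ab by (intro exI[of _ "b / a"]) auto
qed

lemma char_poly_gram_splits:
  fixes A :: "real mat"
  assumes A: "A \<in> carrier_mat m n"
  obtains rs where "char_poly (transpose_mat A * A) = (\<Prod>r\<leftarrow>rs. [:- r, 1:])"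
    "length rs = n" "\<forall>r\<in>set rs. r \<ge> 0"
proof -
  interpret map_poly_of_real: map_poly_inj_idom_hom complex_of_real ..
  let ?B = "transpose_mat A * A"
  have B: "?B \<in> carrier_mat n n" using A by auto
  have BC: "map_mat complex_of_real ?B \<in> carrier_mat n n" using B by auto
  from char_poly_factorized[OF BC] obtain as where
    as: "char_poly (map_mat complex_of_real ?B) = (\<Prod>a\<leftarrow>as. [:- a, 1:])" "length as = n"
    by blast
  have root: "\<exists>r\<ge>0. a = of_real r" if "a \<in> set as" for a
  proof (rule char_poly_gram_root[OF A])
    show "poly (char_poly (map_mat complex_of_real ?B)) a = 0"
      unfolding as(1) poly_prod_list using that by (auto simp: prod_list_zero_iff)
  qed
  define rs where "rs = map Re as"
  have as_rs: "as = map complex_of_real rs"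
    unfolding rs_def using root by (auto simp: o_def intro!: map_idI[symmetric]) (metis Re_complex_of_real)
  have nonneg: "\<forall>r\<in>set rs. r \<ge> 0"
    unfolding rs_def using root by auto (metis Re_complex_of_real)
  have "map_poly complex_of_real (char_poly ?B) = (\<Prod>a\<leftarrow>as. [:- a, 1:])"
    using as(1) of_real_hom.char_poly_hom[OF B] by metis
  also have "\<dots> = map_poly complex_of_real (\<Prod>r\<leftarrow>rs. [:- r, 1:])"
    unfolding as_rs by (simp add: map_poly_of_real.hom_prod_list o_def map_poly_pCons)
  finally have "char_poly ?B = (\<Prod>r\<leftarrow>rs. [:- r, 1:])"
    by (rule map_poly_of_real.injectivity)
  thus ?thesis using that[of rs] nonneg as(2) unfolding rs_def by auto
qed

lemma size_singular_values:
  assumes "A \<in> carrier_mat m n"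
  shows "size (singular_values A) = n"
proof -
  from char_poly_gram_splits[OF assms] obtain rs where
    rs: "char_poly (transpose_mat A * A) = (\<Prod>r\<leftarrow>rs. [:- r, 1:])" "length rs = n" by blast
  have "proots (\<Prod>r\<leftarrow>rs. [:- r, 1:]) = mset rs"
  proof (induction rs)
    case (Cons r rs)
    have "(\<Prod>r\<leftarrow>rs. [:- r, 1:]) \<noteq> 0" by (auto simp: prod_list_zero_iff)
    hence "proots ([:- r, 1:] * (\<Prod>r\<leftarrow>rs. [:- r, 1:])) = {#r#} + proots (\<Prod>r\<leftarrow>rs. [:- r, 1:])"
      by (subst proots_mult) auto
    thus ?case using Cons.IH by (simp only: list.map prod_list.Cons) simp
  qed simp
  thus ?thesis using rs by (simp add: singular_values_def)
qed

end

theory Submission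
  imports Defs "Jordan_Normal_Form.Schur_Decomposition"
begin

text \<open>
  Since the entries of \<open>x\<close> sum to 1, the matrix determinant lemma gives
  \<open>det (t I - A) = \<Prod> (t - x\<^sub>i) (1 + \<Sum> x\<^sub>i\<^sup>2 / (t - x\<^sub>i)) = t \<Prod> (t - x\<^sub>i) \<Sum> x\<^sub>i / (t - x\<^sub>i)\<close>.
  The numerator of the last sum changes sign between consecutive distinct entries, so the
  eigenvalues of \<open>A\<close>, of which 0 is the smallest, interlace the sorted entries; in particular they
  are nonnegative and are the singular values. For an eigenvalue \<open>m\<close> strictly between consecutive
  entries \<open>a > b\<close>, the larger entries contribute nonpositive terms to \<open>\<Sum> x\<^sub>i / (m - x\<^sub>i) = 0\<close>, and
  the entries up to \<open>b\<close> contribute at most \<open>(1 - a) / (m - b)\<close>. Hence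
  \<open>a / (a - m) \<le> (1 - a) / (m - b)\<close>, which rearranges to \<open>m \<le> a (1 - a + b)\<close>.
\<close>

section \<open>Numerators of partial fraction sums\<close>

definition root_poly :: "'a::comm_ring_1 list \<Rightarrow> 'a poly" where
  "root_poly xs = (\<Prod>x\<leftarrow>xs. [:- x, 1:])"

text \<open>The numerator of \<open>\<Sum> w / (t - x)\<close>, summed over the pairs \<open>(x, w)\<close> of the list, over the
  common denominator \<open>\<Prod> (t - x)\<close>.\<close>
fun pole_numerator :: "('a::comm_ring_1 \<times> 'a) list \<Rightarrow> 'a poly" where
  "pole_numerator [] = 0"
| "pole_numerator ((x, w) # zs) =
     Polynomial.smult w (root_poly (map fst zs)) + [:- x, 1:] * pole_numerator zs"

lemma root_poly_simps [simp]:
  "root_poly [] = 1"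
  "root_poly (x # xs) = [:- x, 1:] * root_poly xs"
  "root_poly (xs @ ys) = root_poly xs * root_poly ys"
  by (simp_all add: root_poly_def)

lemma poly_root_poly: "poly (root_poly xs) t = (\<Prod>x\<leftarrow>xs. t - x)"
  by (induction xs) (simp_all add: algebra_simps)

lemma root_poly_nonzero [simp]: "root_poly xs \<noteq> 0"
  for xs :: "'a::idom list"
  by (auto simp: root_poly_def prod_list_zero_iff)

lemma degree_root_poly [simp]: "degree (root_poly xs) = length xs"
  for xs :: "'a::idom list"
proof (induction xs)
  case (Cons x xs)
  thus ?case using degree_mult_eq[of "[:- x, 1:]" "root_poly xs"] by (simp del: mult_pCons_left)
qed simp

lemma lead_coeff_root_poly [simp]: "coeff (root_poly xs) (length xs) = 1"
  for xs :: "'a::idom list"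
proof (induction xs)
  case (Cons x xs)
  thus ?case
    using lead_coeff_mult[of "[:- x, 1:]" "root_poly xs"] degree_root_poly[of "x # xs"]
    by (simp del: mult_pCons_left)
qed simp

lemma proots_root_poly: "proots (root_poly xs) = mset xs"
  for xs :: "'a::idom list"
  by (induction xs) (simp_all add: proots_mult del: mult_pCons_left)

lemma pole_numerator_append:
  "pole_numerator (us @ vs) =
     pole_numerator us * root_poly (map fst vs) + root_poly (map fst us) * pole_numerator vs"
proof (induction us rule: pole_numerator.induct)
  case (2 x w zs)
  define c where "c = [:- x, 1:]"
  show ?case using 2 by (simp add: ring_distribs mult.assoc flip: c_def)
qed simp

lemma poly_pole_numerator:
  fixes t :: "'a::field"
  assumes "t \<notin> fst ` set zs"
  shows "poly (pole_numerator zs) t = (\<Prod>x\<leftarrow>map fst zs. t - x) * (\<Sum>(x, w)\<leftarrow>zs. w / (t - x))"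
  using assms
proof (induction zs rule: pole_numerator.induct)
  case (2 x w zs)
  define P S where "P = (\<Prod>x\<leftarrow>map fst zs. t - x)" and "S = (\<Sum>(x, w)\<leftarrow>zs. w / (t - x))"
  have tx: "t - x \<noteq> 0" and IH: "poly (pole_numerator zs) t = P * S"
    using 2 by (auto simp: P_def S_def)
  have "poly (pole_numerator ((x, w) # zs)) t = w * P + (t - x) * (P * S)"
    by (simp add: poly_root_poly IH P_def del: mult_pCons_left)
  also have "\<dots> = ((t - x) * P) * (w / (t - x) + S)"
    using tx by (simp add: distrib_left)
  finally show ?case by (simp add: P_def S_def)
qed simp

text \<open>Every summand except the one belonging to the chosen pole keeps the factor
  \<open>t - x\<close> and vanishes at \<open>x\<close>. The sign of the surviving product is what
  locates roots later.\<close>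

lemma poly_pole_numerator_at_pole:
  "poly (pole_numerator (us @ (x, w) # vs)) x =
     w * (\<Prod>u\<leftarrow>us. x - fst u) * (\<Prod>v\<leftarrow>vs. x - fst v)"
  by (simp add: pole_numerator_append poly_root_poly o_def mult_ac)

lemma degree_pole_numerator: "degree (pole_numerator zs) \<le> length zs - 1"
  for zs :: "('a::idom \<times> 'a) list"
proof (induction zs rule: pole_numerator.induct)
  case (2 x w zs)
  have "degree (Polynomial.smult w (root_poly (map fst zs))) \<le> length zs"
    by (metis degree_smult_le degree_root_poly length_map)
  moreover have "degree ([:- x, 1:] * pole_numerator zs) \<le> length zs"
  proof (cases zs)
    case (Cons z zs')
    have "degree ([:- x, 1:] * pole_numerator zs) \<le> 1 + degree (pole_numerator zs)"
      using degree_mult_le[of "[:- x, 1:]" "pole_numerator zs"] by simp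
    with 2 Cons show ?thesis by simp
  qed simp
  ultimately show ?case
    by (simp add: degree_add_le del: mult_pCons_left)
qed simp

text \<open>Each summand is its weight times a monic polynomial of degree
  \<open>length zs - 1\<close>. The degree itself can be smaller when the weights cancel, so the
  coefficient is taken at this fixed position.\<close>

lemma coeff_pole_numerator: "coeff (pole_numerator zs) (length zs - 1) = (\<Sum>z\<leftarrow>zs. snd z)"
  for zs :: "('a::idom \<times> 'a) list"
proof (induction zs rule: pole_numerator.induct)
  case (2 x w zs)
  have r: "coeff (root_poly (map fst zs)) (length zs) = 1"
    using lead_coeff_root_poly[of "map fst zs"] by simp
  show ?case
  proof (cases zs)
    case (Cons z zs')
    have "coeff (pole_numerator zs) (length zs) = 0"
      using degree_pole_numerator[of zs] Cons by (intro coeff_eq_0) simp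
    moreover have "coeff (pole_numerator zs) (length zs - 1) = (\<Sum>z\<leftarrow>zs. snd z)"
      by (fact 2)
    ultimately have "coeff ([:- x, 1:] * pole_numerator zs) (length zs) = (\<Sum>z\<leftarrow>zs. snd z)"
      using Cons by (simp add: coeff_pCons)
    with r show ?thesis by (simp del: mult_pCons_left)
  qed simp
qed simp

text \<open>The two fractions add up to the single fraction \<open>(w + w') / (t - x)\<close>, but
  the common denominator contains \<open>t - x\<close> once more than after merging, which leaves
  one extra factor.\<close>

lemma pole_numerator_merge:
  "pole_numerator (us @ (x, w) # (x, w') # vs) =
     [:- x, 1:] * pole_numerator (us @ (x, w + w') # vs)"
proof -
  define c where "c = [:- x, 1:]"
  define U U' V V' where "U = root_poly (map fst us)" and "U' = pole_numerator us"
    and "V = root_poly (map fst vs)" and "V' = pole_numerator vs"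
  have "pole_numerator (us @ (x, w) # (x, w') # vs) =
      U' * (c * (c * V)) + U * (Polynomial.smult w (c * V) + c * (Polynomial.smult w' V + c * V'))"
    by (simp add: pole_numerator_append flip: c_def U_def U'_def V_def V'_def)
  also have "\<dots> = c * (U' * (c * V) + U * (Polynomial.smult (w + w') V + c * V'))"
    by (simp add: algebra_simps smult_add_left)
  also have "\<dots> = c * pole_numerator (us @ (x, w + w') # vs)"
    by (simp add: pole_numerator_append flip: c_def U_def U'_def V_def V'_def)
  finally show ?thesis unfolding c_def .
qed

section \<open>Interlacing of poles and roots\<close>

lemma prod_list_pos: "(\<And>x. x \<in> set xs \<Longrightarrow> 0 < f x) \<Longrightarrow> 0 < (\<Prod>x\<leftarrow>xs. f x)"
  for f :: "'a \<Rightarrow> 'b::linordered_idom"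
  by (induction xs) auto

lemma prod_list_mult: "(\<Prod>x\<leftarrow>xs. f x * g x) = (\<Prod>x\<leftarrow>xs. f x) * (\<Prod>x\<leftarrow>xs. g x)"
  for f :: "'a \<Rightarrow> 'b::comm_monoid_mult"
  by (induction xs) (simp_all add: mult_ac)

text \<open>Of the factors coming from other poles, those in \<open>us\<close> have products of
  equal sign at \<open>a\<close> and \<open>b\<close>, those in \<open>vs\<close> are positive at
  both, and the mutual factors \<open>a - b\<close> and \<open>b - a\<close> are opposite. With
  \<open>w' > 0\<close> the intermediate value theorem applies; with \<open>w' = 0\<close> the point
  \<open>b\<close> is itself a root.\<close>

lemma pole_numerator_root_between:
  fixes a b :: real
  assumes us: "\<And>u. u \<in> set us \<Longrightarrow> a < fst u" and vs: "\<And>v. v \<in> set vs \<Longrightarrow> fst v < b"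
    and ab: "b < a" and w: "0 < w" "0 \<le> w'"
  shows "\<exists>m. b \<le> m \<and> m < a \<and> poly (pole_numerator (us @ (a, w) # (b, w') # vs)) m = 0"
proof -
  let ?q = "pole_numerator (us @ (a, w) # (b, w') # vs)"
  define U V where "U t = (\<Prod>u\<leftarrow>us. t - fst u)" and "V t = (\<Prod>v\<leftarrow>vs. t - fst v)" for t
  \<comment> \<open>Both points lie below every pole in \<open>us\<close>; pairing the factors
    avoids the parity of \<open>length us\<close>.\<close>
  have "0 < (a - fst u) * (b - fst u)" if "u \<in> set us" for u
    using us[OF that] ab by (intro mult_neg_neg) simp_all
  hence "0 < (\<Prod>u\<leftarrow>us. (a - fst u) * (b - fst u))"
    by (rule prod_list_pos)
  hence U: "0 < U a * U b" by (simp add: U_def prod_list_mult)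
  have "0 < a - fst v" "0 < b - fst v" if "v \<in> set vs" for v
    using vs[OF that] ab by simp_all
  hence V: "0 < V a" "0 < V b"
    unfolding V_def by (auto intro: prod_list_pos)
  have qa: "poly ?q a = w * U a * ((a - b) * V a)"
    using poly_pole_numerator_at_pole[of us a w "(b, w') # vs"] by (simp add: U_def V_def)
  have qb: "poly ?q b = w' * (U b * (b - a)) * V b"
    using poly_pole_numerator_at_pole[of "us @ [(a, w)]" b w' vs] by (simp add: U_def V_def)
  have "poly ?q a \<noteq> 0" using qa U V w ab by auto
  show ?thesis
  proof (cases "poly ?q b = 0")
    case True
    with ab show ?thesis by blast
  next
    case False
    hence "0 < w'" using qb w by (cases "w' = 0") auto
    have "poly ?q b * poly ?q a = - ((a - b)\<^sup>2 * (w * w' * (U a * U b) * (V a * V b)))"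
      unfolding qa qb by (simp add: power2_eq_square algebra_simps)
    also have "\<dots> < 0" using ab w \<open>0 < w'\<close> U V by (simp add: zero_less_mult_iff)
    finally show ?thesis using poly_IVT[OF ab, of ?q] by (auto intro: less_imp_le)
  qed
qed

text \<open>One root in each of the n - 1 gaps exhausts the degree, and the top coefficient fixes
  the scalar. By \<open>pos\<close> a zero weight can occur only at the least pole, which is the
  upper end of no gap.\<close>

lemma pole_numerator_interlacing_strict:
  fixes zs :: "(real \<times> real) list"
  assumes ne: "zs \<noteq> []" and sorted: "sorted_wrt (>) (map fst zs)"
    and nonneg: "\<And>z. z \<in> set zs \<Longrightarrow> 0 \<le> snd z"
    and pos: "\<And>z y. z \<in> set zs \<Longrightarrow> y \<in> set zs \<Longrightarrow> 0 < snd z \<or> fst z \<le> fst y"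
  shows "\<exists>ms. length zs = Suc (length ms) \<and>
    pole_numerator zs = Polynomial.smult (\<Sum>z\<leftarrow>zs. snd z) (root_poly ms) \<and>
    (\<forall>i<length ms. fst (zs ! Suc i) \<le> ms ! i \<and> ms ! i < fst (zs ! i))"
proof -
  let ?q = "pole_numerator zs" and ?n = "length zs - 1"
  have less: "fst (zs ! j) < fst (zs ! i)" if "i < j" "j < length zs" for i j
    using sorted that by (auto simp: sorted_wrt_iff_nth_less)
  have "\<exists>m. fst (zs ! Suc i) \<le> m \<and> m < fst (zs ! i) \<and> poly ?q m = 0" if i: "i < ?n" for i
  proof -
    from i have i': "Suc i < length zs" by simp
    have "zs = take i zs @ zs ! i # zs ! Suc i # drop (Suc (Suc i)) zs"
      using i' by (simp add: Cons_nth_drop_Suc)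
    hence eq: "zs = take i zs @ (fst (zs ! i), snd (zs ! i)) # (fst (zs ! Suc i), snd (zs ! Suc i))
        # drop (Suc (Suc i)) zs" by simp
    show ?thesis
    proof (subst eq, rule pole_numerator_root_between)
      show "fst (zs ! i) < fst u" if "u \<in> set (take i zs)" for u
        using that i' less by (auto simp: in_set_conv_nth)
      show "fst v < fst (zs ! Suc i)" if "v \<in> set (drop (Suc (Suc i)) zs)" for v
        using that i' less by (auto simp: in_set_conv_nth)
      show "fst (zs ! Suc i) < fst (zs ! i)" using less i' by simp
      thus "0 < snd (zs ! i)" using pos[of "zs ! i" "zs ! Suc i"] i' by auto
      show "0 \<le> snd (zs ! Suc i)" using nonneg i' by simp
    qed
  qed
  then obtain f where f: "\<And>i. i < ?n \<Longrightarrow> fst (zs ! Suc i) \<le> f i \<and> f i < fst (zs ! i) \<and> poly ?q (f i) = 0"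
    by metis
  define ms where "ms = map f [0..<?n]"
  have nth: "ms ! i = f i" if "i < ?n" for i
    using that by (simp add: ms_def)
  have len: "length ms = ?n" by (simp add: ms_def)
  \<comment> \<open>The gaps, closed below and open above, are disjoint, so the chosen roots are
    distinct.\<close>
  have decreasing: "f j < f i" if "i < j" "j < ?n" for i j
  proof -
    have "f j < fst (zs ! j)" using f that by simp
    also have "\<dots> \<le> fst (zs ! Suc i)"
    proof (cases "j = Suc i")
      case False
      with that have "Suc i < j" "j < length zs" by auto
      from less[OF this] show ?thesis by simp
    qed simp
    also have "\<dots> \<le> f i" using f that by simp
    finally show ?thesis .
  qed
  have "inj_on f {0..<?n}"
  proof (rule linorder_inj_onI)
    fix i j assume "i < j" "j \<in> {0..<?n}"
    thus "f i \<noteq> f j" using decreasing[of i j] by simp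
  qed auto
  hence card: "card (set ms) = ?n" by (simp add: ms_def card_image)
  have "?q = Polynomial.smult (\<Sum>z\<leftarrow>zs. snd z) (root_poly ms)"
  \<comment> \<open>With equal coefficients at \<open>?n\<close>, the difference is zero or of
    degree below \<open>?n\<close>, yet it vanishes at \<open>?n\<close> distinct points.\<close>
  proof (rule poly_eqI_degree_lead_coeff)
    show "coeff ?q ?n = coeff (Polynomial.smult (\<Sum>z\<leftarrow>zs. snd z) (root_poly ms)) ?n"
      using lead_coeff_root_poly[of ms] coeff_pole_numerator[of zs] by (simp add: len)
    show "card (set ms) \<ge> ?n" by (simp add: card)
    show "degree ?q \<le> ?n" by (rule degree_pole_numerator)
    show "degree (Polynomial.smult (\<Sum>z\<leftarrow>zs. snd z) (root_poly ms)) \<le> ?n"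
      using degree_smult_le[of _ "root_poly ms"] by (simp add: len)
    show "poly ?q z = poly (Polynomial.smult (\<Sum>z\<leftarrow>zs. snd z) (root_poly ms)) z" if "z \<in> set ms" for z
    proof -
      have "(\<Prod>x\<leftarrow>ms. z - x) = 0" using that by (auto simp: prod_list_zero_iff)
      moreover have "poly ?q z = 0" using that f by (auto simp: ms_def)
      ultimately show ?thesis by (simp add: poly_root_poly)
    qed
  qed
  thus ?thesis using f len ne by (intro exI[of _ ms]) (auto simp: nth)
qed

text \<open>Equal poles are merged until all are distinct. Strictness at the upper end keeps a root in a
  nondegenerate gap off its upper pole, so that the partial fraction sum can be evaluated there.\<close>
lemma pole_numerator_interlacing:
  fixes zs :: "(real \<times> real) list"
  assumes "zs \<noteq> []" and "sorted_wrt (\<ge>) (map fst zs)"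
    and "\<And>z. z \<in> set zs \<Longrightarrow> 0 \<le> snd z"
    and "\<And>z y. z \<in> set zs \<Longrightarrow> y \<in> set zs \<Longrightarrow> 0 < snd z \<or> fst z \<le> fst y"
  shows "\<exists>ms. length zs = Suc (length ms) \<and>
    pole_numerator zs = Polynomial.smult (\<Sum>z\<leftarrow>zs. snd z) (root_poly ms) \<and>
    (\<forall>i<length ms. fst (zs ! Suc i) \<le> ms ! i \<and> ms ! i \<le> fst (zs ! i) \<and>
       (fst (zs ! Suc i) < fst (zs ! i) \<longrightarrow> ms ! i < fst (zs ! i)))"
  using assms
proof (induction "length zs" arbitrary: zs)
  case 0
  thus ?case by simp
next
  case (Suc n)
  show ?case
  proof (cases "distinct (map fst zs)")
    case True
    hence "sorted_wrt (>) (map fst zs)"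
      using Suc.prems(2) by (auto simp: sorted_wrt_iff_nth_less distinct_conv_nth)
        (metis order_le_less less_irrefl order.strict_trans)
    from pole_numerator_interlacing_strict[OF Suc.prems(1) this Suc.prems(3,4)]
    show ?thesis by (meson order.strict_implies_order)
  next
    case False
    \<comment> \<open>In a sorted list a repeated pole occurs at adjacent positions.\<close>
    have "\<exists>k. Suc k < length zs \<and> fst (zs ! k) = fst (zs ! Suc k)"
    proof -
      from False obtain i j where ij: "i < j" "j < length zs" "fst (zs ! i) = fst (zs ! j)"
        by (auto simp: distinct_conv_nth) (metis nat_neq_iff)
      have mono: "fst (zs ! j) \<le> fst (zs ! i)" if "i \<le> j" "j < length zs" for i j
        using Suc.prems(2) that by (cases "i = j") (auto simp: sorted_wrt_iff_nth_less)
      have "fst (zs ! i) = fst (zs ! Suc i)"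
        using mono[of i "Suc i"] mono[of "Suc i" j] ij by auto
      with ij show ?thesis by (intro exI[of _ i]) auto
    qed
    then obtain k where k: "Suc k < length zs" "fst (zs ! k) = fst (zs ! Suc k)" by blast
    define us vs x w w' where "us = take k zs" and "vs = drop (Suc (Suc k)) zs"
      and "x = fst (zs ! k)" and "w = snd (zs ! k)" and "w' = snd (zs ! Suc k)"
    have "zs = take k zs @ zs ! k # zs ! Suc k # drop (Suc (Suc k)) zs"
      using k by (simp add: Cons_nth_drop_Suc)
    moreover have "zs ! k = (x, w)" "zs ! Suc k = (x, w')"
      using k by (simp_all add: x_def w_def w'_def prod_eq_iff)
    ultimately have zs: "zs = us @ (x, w) # (x, w') # vs" unfolding us_def vs_def by simp
    have lus: "length us = k" using k by (simp add: us_def)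
    define ys where "ys = us @ (x, w + w') # vs"
    have "\<exists>ms. length ys = Suc (length ms) \<and>
      pole_numerator ys = Polynomial.smult (\<Sum>z\<leftarrow>ys. snd z) (root_poly ms) \<and>
      (\<forall>i<length ms. fst (ys ! Suc i) \<le> ms ! i \<and> ms ! i \<le> fst (ys ! i) \<and>
         (fst (ys ! Suc i) < fst (ys ! i) \<longrightarrow> ms ! i < fst (ys ! i)))"
    proof (rule Suc.hyps)
      show "n = length ys" using Suc.hyps(2) by (simp add: zs ys_def)
      show "ys \<noteq> []" by (simp add: ys_def)
      show "sorted_wrt (\<ge>) (map fst ys)"
        using Suc.prems(2) by (auto simp: zs ys_def sorted_wrt_append)
      show "0 \<le> snd z" if "z \<in> set ys" for z
        using that Suc.prems(3)[of z] Suc.prems(3)[of "(x, w)"] Suc.prems(3)[of "(x, w')"]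
        by (auto simp: zs ys_def)
      show "0 < snd z \<or> fst z \<le> fst y" if z: "z \<in> set ys" and y: "y \<in> set ys" for z y
      proof -
        \<comment> \<open>\<open>y\<close> may be the merged pair, which need not occur in
          \<open>zs\<close>; only its pole matters for the comparison.\<close>
        have "fst y \<in> fst ` set zs" using y by (auto simp: zs ys_def)
        then obtain y' where y': "y' \<in> set zs" "fst y' = fst y" by (metis imageE)
        show ?thesis
        proof (cases "z = (x, w + w')")
          case True
          thus ?thesis using Suc.prems(3)[of "(x, w')"] Suc.prems(4)[of "(x, w)" y'] y'
            by (auto simp: zs)
        next
          case False
          thus ?thesis using Suc.prems(4)[of z y'] z y' by (auto simp: zs ys_def)
        qed
      qed
    qed
    then obtain ms where len: "length ys = Suc (length ms)"
      and poly: "pole_numerator ys = Polynomial.smult (\<Sum>z\<leftarrow>ys. snd z) (root_poly ms)"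
      and ms: "\<And>i. i < length ms \<Longrightarrow> fst (ys ! Suc i) \<le> ms ! i \<and> ms ! i \<le> fst (ys ! i) \<and>
         (fst (ys ! Suc i) < fst (ys ! i) \<longrightarrow> ms ! i < fst (ys ! i))"
      by blast
    have kms: "k \<le> length ms" using len lus by (simp add: ys_def)
    \<comment> \<open>The extra factor from merging gives the root \<open>x\<close>. At index
      \<open>k\<close> it sits in the degenerate gap between the two equal poles; later roots and
      poles shift by one.\<close>
    define ms' where "ms' = take k ms @ x # drop k ms"
    have "root_poly ms = root_poly (take k ms) * root_poly (drop k ms)"
      by (simp flip: root_poly_simps(3))
    hence "root_poly ms' = [:- x, 1:] * root_poly ms"
      by (simp add: ms'_def algebra_simps del: mult_pCons_left)
    hence "pole_numerator zs = Polynomial.smult (\<Sum>z\<leftarrow>zs. snd z) (root_poly ms')"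
      using pole_numerator_merge[of us x w w' vs] poly
      by (simp add: zs ys_def add.assoc del: mult_pCons_left)
    moreover have "length zs = Suc (length ms')"
      using len by (simp add: zs ys_def ms'_def)
    moreover have "fst (zs ! Suc i) \<le> ms' ! i \<and> ms' ! i \<le> fst (zs ! i) \<and>
         (fst (zs ! Suc i) < fst (zs ! i) \<longrightarrow> ms' ! i < fst (zs ! i))" if i: "i < length ms'" for i
    proof -
      have zs_low: "fst (zs ! j) = fst (ys ! j)" if "j \<le> k" for j
        using that by (cases "j = k") (simp_all add: zs ys_def nth_append lus)
      have zs_high: "fst (zs ! Suc j) = fst (ys ! j)" if "k \<le> j" for j
        using that by (cases "j = k") (simp_all add: zs ys_def nth_append lus nth_Cons')
      have ms_low: "ms' ! j = ms ! j" if "j < k" for j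
        using that kms by (simp add: ms'_def nth_append)
      have ms_high: "ms' ! Suc j = ms ! j" if "k \<le> j" for j
        using that kms by (simp add: ms'_def nth_append Suc_diff_le)
      show ?thesis
      proof (cases i k rule: linorder_cases)
        case less
        thus ?thesis using ms[of i] kms zs_low[of i] zs_low[of "Suc i"] ms_low[of i] by simp
      next
        case equal
        moreover have "ms' ! k = x" using kms by (simp add: ms'_def nth_append)
        ultimately show ?thesis using k by (simp add: x_def)
      next
        case greater
        then obtain j where j: "i = Suc j" "k \<le> j" by (cases i) auto
        moreover have "j < length ms" using i j kms by (simp add: ms'_def)
        ultimately show ?thesis
          using ms[of j] zs_high[of j] zs_high[of "Suc j"] ms_high[of j] by simp
      qed
    qed
    ultimately show ?thesis by blast
  qed
qed

section \<open>Determinant of a diagonal matrix plus a rank-one matrix\<close>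

text \<open>The bordered matrix with rows \<open>(1, - v\<^sup>T)\<close> and \<open>(u, D)\<close> has two block factorisations,
  one involving \<open>D + u v\<^sup>T\<close> and the other the scalar \<open>1 + v\<^sup>T D\<^sup>-\<^sup>1 u\<close>.\<close>
lemma det_diag_plus_rank_one:
  fixes d u v :: "nat \<Rightarrow> 'a::field"
  assumes d: "\<And>i. i < n \<Longrightarrow> d i \<noteq> 0"
  shows "det (mat n n (\<lambda>(i, j). (if i = j then d i else 0) + u i * v j)) =
    (\<Prod>i<n. d i) * (1 + (\<Sum>i<n. u i * v i / d i))"
proof -
  define M where "M = mat n n (\<lambda>(i, j). (if i = j then d i else 0) + u i * v j)"
  define D where "D = mat_diag n d"
  define U V W where "U = mat n 1 (\<lambda>(i, j). u i)" and "V = mat 1 n (\<lambda>(i, j). - v j)"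
    and "W = mat n 1 (\<lambda>(i, j). u i / d i)"
  define S where "S = mat 1 1 (\<lambda>(i, j). 1 + (\<Sum>i<n. u i * v i / d i))"
  note defs = M_def D_def mat_diag_def U_def V_def W_def S_def
  have carrier [simp]: "M \<in> carrier_mat n n" "D \<in> carrier_mat n n" "U \<in> carrier_mat n 1"
    "V \<in> carrier_mat 1 n" "W \<in> carrier_mat n 1" "S \<in> carrier_mat 1 1"
    by (simp_all add: defs)
  note dims = carrier[THEN carrier_matD(1)] carrier[THEN carrier_matD(2)]
  have UV: "U * V + M = D"
    by (rule eq_matI) (auto simp: defs scalar_prod_def)
  have DW: "D * W = U"
    by (rule eq_matI) (auto simp: D_def U_def W_def d mat_diag_mult_left[of _ n 1])
  have VW: "S + V * W = 1\<^sub>m 1"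
    by (rule eq_matI) (auto simp: defs scalar_prod_def sum_negf mult.commute atLeast0LessThan)
  \<comment> \<open>Eliminating with the corner entry 1 as pivot leaves the Schur complement
    \<open>D - U * V = M\<close>; eliminating with \<open>D\<close> as pivot leaves the scalar block
    \<open>S\<close>, where \<open>W\<close> stands for the inverse of \<open>D\<close> applied to
    \<open>U\<close>.\<close>
  define X X' Y Y' where "X = four_block_mat (1\<^sub>m 1) (0\<^sub>m 1 n) U (1\<^sub>m n)"
    and "X' = four_block_mat (1\<^sub>m 1) V (0\<^sub>m n 1) M"
    and "Y = four_block_mat S V (0\<^sub>m n 1) D"
    and "Y' = four_block_mat (1\<^sub>m 1) (0\<^sub>m 1 n) W (1\<^sub>m n)"
  have XY: "X \<in> carrier_mat (1 + n) (1 + n)" "X' \<in> carrier_mat (1 + n) (1 + n)"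
    "Y \<in> carrier_mat (1 + n) (1 + n)" "Y' \<in> carrier_mat (1 + n) (1 + n)"
    unfolding X_def X'_def Y_def Y'_def by (intro four_block_carrier_mat carrier one_carrier_mat)+
  have "X * X' = four_block_mat (1\<^sub>m 1) V U D" unfolding X_def X'_def
    using UV by (subst mult_four_block_mat[of _ 1 1 _ n _ n _ _ 1 _ n])
      (auto simp: dims simp del: One_nat_def)
  moreover have "Y * Y' = four_block_mat (1\<^sub>m 1) V U D" unfolding Y_def Y'_def
    using DW VW by (subst mult_four_block_mat[of _ 1 1 _ n _ n _ _ 1 _ n])
      (auto simp: dims simp del: One_nat_def)
  ultimately have "det X * det X' = det Y * det Y'"
    using det_mult[OF XY(1,2)] det_mult[OF XY(3,4)] by simp
  moreover have "det X = 1" "det X' = det M" "det Y = det S * det D" "det Y' = 1"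
    unfolding X_def X'_def Y_def Y'_def
    by (simp_all add: det_four_block_mat_upper_right_zero[of _ 1 _ n]
        det_four_block_mat_lower_left_zero[of _ 1 _ n] del: One_nat_def)
  ultimately have "det M = det S * det D" by simp
  also have "det D = (\<Prod>i<n. d i)"
    by (subst det_upper_triangular[of _ n])
      (auto simp: D_def mat_diag_def upper_triangular_def diag_mat_def prod.list_conv_set_nth atLeast0LessThan)
  also have "det S = 1 + (\<Sum>i<n. u i * v i / d i)"
    by (subst det_upper_triangular[of _ 1]) (auto simp: S_def upper_triangular_def diag_mat_def)
  finally show ?thesis by (simp add: M_def mult.commute)
qed

section \<open>Singular values of symmetric matrices\<close>

text \<open>Schur decomposition makes \<open>A\<close> similar to an upper triangular
  \<open>B\<close> with diagonal \<open>es\<close>. Then \<open>A * A\<close> is similar to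
  \<open>B * B\<close>, which is upper triangular with the squared diagonal.\<close>

lemma char_poly_square:
  fixes A :: "'a::conjugatable_ordered_field mat"
  assumes A: "A \<in> carrier_mat n n" and es: "char_poly A = root_poly es"
  shows "char_poly (A * A) = root_poly (map (\<lambda>e. e * e) es)"
proof -
  obtain B P Q where "schur_decomposition A es = (B, P, Q)" by (cases "schur_decomposition A es")
  from schur_decomposition[OF A es[unfolded root_poly_def] this]
  have sim: "similar_mat_wit A B P Q" and B: "upper_triangular B" and diag: "diag_mat B = es"
    by auto
  note PQ = similar_mat_witD2[OF A sim]
  have "A * A = P * B * Q * (P * B * Q)"
    by (simp flip: PQ(3))
  also have "\<dots> = P * B * (Q * P) * (B * Q)"
    using PQ(5-7) by (simp add: assoc_mult_mat[of _ n n _ n _ n])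
  finally have "A * A = P * B * 1\<^sub>m n * (B * Q)"
    unfolding PQ(2) .
  hence sq: "A * A = P * (B * B) * Q"
    using PQ by (simp add: assoc_mult_mat[of _ n n _ n _ n])
  have "similar_mat_wit (A * A) (B * B) P Q"
    by (rule similar_mat_witI[OF PQ(1,2) sq mult_carrier_mat[OF PQ(4,4)]
          mult_carrier_mat[OF PQ(5,5)] PQ(6,7)])
  hence "similar_mat (A * A) (B * B)"
    unfolding similar_mat_def by blast
  hence "char_poly (A * A) = char_poly (B * B)" by (rule char_poly_similar)
  \<comment> \<open>A term \<open>B $$ (i, k) * B $$ (k, j)\<close> can be nonzero only for
    \<open>i \<le> k \<le> j\<close>, so with \<open>j \<le> i\<close> only \<open>k = i = j\<close>
    survives.\<close>
  moreover have entry: "(B * B) $$ (i, j) = (if i = j then B $$ (i, i) * B $$ (i, i) else 0)"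
    if "j \<le> i" "i < n" for i j
  proof -
    have zero: "B $$ (i, k) * B $$ (k, j) = 0" if "k < n" "k \<noteq> i \<or> j < i" for k
      using upper_triangularD[OF B, of k i] upper_triangularD[OF B, of j k] that \<open>j \<le> i\<close> \<open>i < n\<close> PQ(5)
      by (cases "k < i") auto
    have "(B * B) $$ (i, j) = (\<Sum>k\<in>{0..<n}. B $$ (i, k) * B $$ (k, j))"
      using that PQ(5) by (simp add: scalar_prod_def)
    also have "\<dots> = (\<Sum>k\<in>{i}. B $$ (i, k) * B $$ (k, j))"
      using zero that by (intro sum.mono_neutral_right) auto
    finally show ?thesis using zero[of i] that by auto
  qed
  have "upper_triangular (B * B)"
    using entry PQ(5) by (intro upper_triangularI) auto
  hence "char_poly (B * B) = root_poly (diag_mat (B * B))"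
    using char_poly_upper_triangular[of "B * B" n] PQ(5) by (simp add: root_poly_def)
  moreover have "diag_mat (B * B) = map (\<lambda>e. e * e) es"
    using entry PQ(5) unfolding diag[symmetric] by (auto simp: diag_mat_def)
  ultimately show ?thesis by simp
qed

text \<open>By symmetry the Gram matrix is \<open>A * A\<close>, whose eigenvalues are the squares;
  nonnegativity lets the square root undo the squaring.\<close>

lemma singular_values_symmetric:
  fixes A :: "real mat"
  assumes A: "A \<in> carrier_mat n n" and sym: "transpose_mat A = A"
    and es: "char_poly A = root_poly es" and nonneg: "\<And>e. e \<in> set es \<Longrightarrow> 0 \<le> e"
  shows "singular_values A = mset es"
proof -
  have "map (\<lambda>e. sqrt (e * e)) es = es"
    using nonneg by (intro map_idI) simp
  hence "image_mset (\<lambda>e. sqrt (e * e)) (mset es) = mset es"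
    by (metis mset_map)
  thus ?thesis
    by (simp add: singular_values_def sym char_poly_square[OF A es] proots_root_poly
        multiset.map_comp o_def)
qed

section \<open>Eigenvalues of \<open>diag(x) - x x^T\<close>\<close>

text \<open>Both sides agree at every \<open>t\<close> that is not an entry of \<open>x\<close>, by
  the determinant formula, hence at infinitely many points. Taking \<open>xs\<close> as any
  rearrangement of the entries allows a sorted list later.\<close>

lemma char_poly_diag_minus_outer:
  fixes x :: "'a::field_char_0 vec"
  assumes x: "x \<in> carrier_vec N" and xs: "mset xs = mset (list_of_vec x)" and sum: "sum_list xs = 1"
  shows "char_poly (mat_diag N (\<lambda>i. x $ i) - outer_prod x x) =
    [:0, 1:] * pole_numerator (map (\<lambda>x. (x, x)) xs)" (is "char_poly ?A = ?q")
proof (rule ccontr)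
  assume "char_poly ?A \<noteq> ?q"
  hence "finite {t. poly (char_poly ?A - ?q) t = 0}"
    by (intro poly_roots_finite) simp
  moreover have "- set xs \<subseteq> {t. poly (char_poly ?A - ?q) t = 0}"
  proof safe
    fix t assume t: "t \<notin> set xs"
    have A: "?A \<in> carrier_mat N N"
      using x by (intro minus_carrier_mat) (auto simp: outer_prod_def)
    have x_eq: "list_of_vec x = map (($) x) [0..<N]"
      using x by (simp add: list_of_vec_map)
    have "set xs = set (list_of_vec x)" using xs by (rule mset_eq_setD)
    hence tx: "t - x $ i \<noteq> 0" if "i < N" for i
      using t that by (auto simp: x_eq)
    have prod: "(\<Prod>y\<leftarrow>xs. f y) = (\<Prod>i<N. f (x $ i))" for f :: "'a \<Rightarrow> 'a"
    proof -
      have "(\<Prod>y\<leftarrow>xs. f y) = (\<Prod>y\<leftarrow>list_of_vec x. f y)"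
        by (simp add: xs flip: prod_mset_prod_list)
      thus ?thesis
        by (simp add: x_eq o_def prod.list_conv_set_nth atLeast0LessThan)
    qed
    have sum': "(\<Sum>y\<leftarrow>xs. f y) = (\<Sum>i<N. f (x $ i))" for f :: "'a \<Rightarrow> 'a"
    proof -
      have "(\<Sum>y\<leftarrow>xs. f y) = (\<Sum>y\<leftarrow>list_of_vec x. f y)"
        by (simp add: xs flip: sum_mset_sum_list)
      thus ?thesis
        by (simp add: x_eq o_def sum_list_sum_nth atLeast0LessThan)
    qed
    have "poly (char_poly ?A) t =
        det (mat N N (\<lambda>(i, j). (if i = j then t - x $ i else 0) + x $ i * x $ j))"
      unfolding char_poly_matrix[OF A] using x
      by (intro arg_cong[where f = det] eq_matI) (auto simp: char_matrix_def outer_prod_def mat_diag_def)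
    also have "\<dots> = (\<Prod>i<N. t - x $ i) * (1 + (\<Sum>i<N. x $ i * x $ i / (t - x $ i)))"
      by (rule det_diag_plus_rank_one) (use tx in auto)
    \<comment> \<open>Writing 1 as the sum of the entries turns each term into
      \<open>x + x^2 / (t - x) = t * x / (t - x)\<close>, which releases the factor
      \<open>t\<close>.\<close>
    also have "1 + (\<Sum>i<N. x $ i * x $ i / (t - x $ i)) = (\<Sum>i<N. x $ i + x $ i * x $ i / (t - x $ i))"
      using sum'[of id] sum by (simp add: sum.distrib)
    also have "\<dots> = (\<Sum>i<N. t * (x $ i / (t - x $ i)))"
      by (rule sum.cong) (use tx in \<open>auto simp: field_simps\<close>)
    also have "(\<Prod>i<N. t - x $ i) * \<dots> = t * ((\<Prod>y\<leftarrow>xs. t - y) * (\<Sum>y\<leftarrow>xs. y / (t - y)))"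
      unfolding prod sum' by (simp add: sum_distrib_left mult.left_commute)
    also have "\<dots> = poly ?q t"
      using t by (subst poly_mult, subst poly_pole_numerator) (auto simp: o_def image_iff)
    finally show "poly (char_poly ?A - ?q) t = 0" by simp
  qed
  ultimately have "finite (- set xs)" by (rule finite_subset[rotated])
  thus False by (metis List.finite_set finite_compl infinite_UNIV_char_0)
qed

text \<open>The estimate of the partial fraction sum at \<open>m\<close>. The non-strict bounds on
  \<open>us\<close> and \<open>vs\<close> admit further copies of \<open>a\<close> and
  \<open>b\<close>, so ties outside the gap are covered.\<close>

lemma pole_numerator_root_bound:
  fixes a b m :: real
  assumes us: "\<And>u. u \<in> set us \<Longrightarrow> a \<le> u" and vs: "\<And>v. v \<in> set vs \<Longrightarrow> 0 \<le> v \<and> v \<le> b"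
    and b: "0 \<le> b" and m: "b < m" "m < a"
    and sum: "sum_list (us @ a # b # vs) = 1"
    and root: "poly (pole_numerator (map (\<lambda>x. (x, x)) (us @ a # b # vs))) m = 0"
  shows "m \<le> a * (1 - a + b)"
proof -
  let ?xs = "us @ a # b # vs" and ?f = "\<lambda>x. x / (m - x)"
  have ne: "m \<notin> set ?xs" using us vs m by force
  hence "(\<Prod>x\<leftarrow>?xs. m - x) \<noteq> 0" by (auto simp: prod_list_zero_iff)
  moreover have "m \<notin> fst ` set (map (\<lambda>x. (x, x)) ?xs)" using ne by auto
  ultimately have "(\<Sum>x\<leftarrow>?xs. ?f x) = 0"
    using root by (simp add: poly_pole_numerator o_def del: map_append list.map)
  hence zero: "(\<Sum>x\<leftarrow>us. ?f x) + ?f a + (\<Sum>x\<leftarrow>b # vs. ?f x) = 0" by simp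
  have us_le: "(\<Sum>x\<leftarrow>us. ?f x) \<le> 0"
  proof (rule sum_list_nonpos)
    fix y assume "y \<in> set (map ?f us)"
    then obtain u where "u \<in> set us" "y = u / (m - u)" by auto
    thus "y \<le> 0" using us[of u] m b by (auto simp: divide_le_0_iff)
  qed
  have us_ge: "0 \<le> sum_list us"
    using us m b by (intro sum_list_nonneg) force
  \<comment> \<open>Among the poles up to \<open>b\<close>, the denominator \<open>m - b\<close> is
    the smallest.\<close>
  have "(\<Sum>x\<leftarrow>b # vs. ?f x) \<le> (\<Sum>x\<leftarrow>b # vs. x * (1 / (m - b)))"
  proof (rule sum_list_mono)
    fix x assume "x \<in> set (b # vs)"
    hence "0 \<le> x" "x \<le> b" using vs b by auto
    thus "?f x \<le> x * (1 / (m - b))" using m by (simp add: frac_le)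
  qed
  also have "\<dots> = sum_list (b # vs) / (m - b)"
    using sum_list_mult_const[of "\<lambda>x. x" "1 / (m - b)" "b # vs"] by simp
  \<comment> \<open>The total is 1, so the part from \<open>b\<close> downwards is
    \<open>1 - a - sum_list us\<close>.\<close>
  also have "\<dots> \<le> (1 - a) / (m - b)"
    using us_ge sum m by (intro divide_right_mono) auto
  finally have "0 \<le> a / (m - a) + (1 - a) / (m - b)" using zero us_le by linarith
  hence "a / (a - m) \<le> (1 - a) / (m - b)"
    using minus_divide_right[of a "a - m"] by simp
  hence "a * (m - b) \<le> (1 - a) * (a - m)"
    using m by (simp add: divide_le_eq le_divide_eq field_simps)
  thus ?thesis by (simp add: algebra_simps)
qed

section \<open>Sorted entries and the chain of inequalities\<close>

lemma kth_largest_mset: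
  assumes "sorted_wrt (\<ge>) xs"
  shows "kth_largest k (mset xs) = xs ! (k - 1)"
proof -
  have "sorted (rev xs)" using assms by (simp add: sorted_wrt_rev)
  hence "sorted_list_of_multiset (mset xs) = rev xs"
    by (metis mset_rev sorted_list_of_multiset_mset sorted_sort_id)
  thus ?thesis by (simp add: kth_largest_def)
qed

theorem theorem2:
  fixes N :: nat and x :: "real vec" and A :: "real mat"
  assumes x_dim: "x \<in> carrier_vec N"
    and x_nonneg: "\<forall>i<N. x $ i \<ge> 0"
    and x_sum: "vec N (\<lambda>_. 1) \<bullet> x = 1"
    and A_def: "A = mat_diag N (\<lambda>i. x $ i) - outer_prod x x"
  shows "\<forall>k\<in>{1..N}. ranked_entry x k \<ge> g_fun k x
           \<and> g_fun k x \<ge> singular_value A k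
           \<and> (k < N \<longrightarrow> singular_value A k \<ge> ranked_entry x (k + 1))"
proof -
  define xs where "xs = rev (sorted_list_of_multiset (mset (list_of_vec x)))"
  define zs where "zs = map (\<lambda>x. (x, x)) xs"
  have mset_xs: "mset xs = mset (list_of_vec x)" by (simp add: xs_def)
  have sorted: "sorted_wrt (\<ge>) xs" by (simp add: xs_def sorted_wrt_rev)
  have len: "length xs = N"
    using x_dim mset_xs by (metis size_mset length_list_of_vec carrier_vecD)
  have "set xs = set (list_of_vec x)" using mset_xs by (rule mset_eq_setD)
  hence nonneg: "0 \<le> y" if "y \<in> set xs" for y
    using that x_nonneg x_dim by (auto simp: list_of_vec_map)
  have sum: "sum_list xs = 1"
  proof -
    have "sum_list xs = sum_list (list_of_vec x)"
      by (metis mset_xs sum_mset_sum_list)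
    also have "\<dots> = (\<Sum>i = 0..<N. x $ i)"
      using x_dim by (simp add: list_of_vec_map sum_list_sum_nth)
    also have "\<dots> = 1" using x_sum x_dim by (simp add: scalar_prod_def)
    finally show ?thesis .
  qed
  have rank: "ranked_entry x k = xs ! (k - 1)" for k
    by (simp add: ranked_entry_def kth_largest_def xs_def)
  have mono: "xs ! j \<le> xs ! i" if "i \<le> j" "j < N" for i j
    using sorted that len by (cases "i = j") (auto simp: sorted_wrt_iff_nth_less)
  have "xs \<noteq> []" using sum by auto
  \<comment> \<open>Weights equal poles here, so a zero weight means a zero entry, which is minimal
    because all entries are nonnegative. The weights sum to 1, so the scalar below
    disappears.\<close>
  have "\<exists>ms. length zs = Suc (length ms) \<and>
      pole_numerator zs = Polynomial.smult (\<Sum>z\<leftarrow>zs. snd z) (root_poly ms) \<and>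
      (\<forall>i<length ms. fst (zs ! Suc i) \<le> ms ! i \<and> ms ! i \<le> fst (zs ! i) \<and>
         (fst (zs ! Suc i) < fst (zs ! i) \<longrightarrow> ms ! i < fst (zs ! i)))"
    using \<open>xs \<noteq> []\<close> sorted nonneg
    by (intro pole_numerator_interlacing) (force simp: zs_def o_def)+
  then obtain ms where len_ms: "N = Suc (length ms)"
    and num: "pole_numerator zs = root_poly ms"
    and ms: "\<And>i. i < length ms \<Longrightarrow> xs ! Suc i \<le> ms ! i \<and> ms ! i \<le> xs ! i \<and>
       (xs ! Suc i < xs ! i \<longrightarrow> ms ! i < xs ! i)"
    using len sum by (auto simp: zs_def o_def)
  \<comment> \<open>The factor \<open>t\<close> contributes the eigenvalue 0, with the all-ones
    vector in the kernel of \<open>A\<close>. It goes last, below the nonnegative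
    \<open>ms\<close>.\<close>
  define es where "es = ms @ [0]"
  have char: "char_poly A = root_poly es"
    unfolding A_def char_poly_diag_minus_outer[OF x_dim mset_xs sum]
    using num by (simp add: zs_def es_def mult.commute)
  have es_ge: "xs ! Suc i \<le> es ! i" if "Suc i < N" for i
    using ms[of i] that len_ms by (simp add: es_def nth_append)
  have es_le: "es ! i \<le> xs ! i" if "i < N" for i
    using ms[of i] that len_ms nonneg[of "xs ! i"] len by (auto simp: es_def nth_append)
  have sorted_es: "sorted_wrt (\<ge>) es"
  proof (subst sorted_wrt_iff_nth_Suc_transp)
    show "transp ((\<ge>) :: real \<Rightarrow> _)" by (auto intro: transpI)
    have "es ! Suc i \<le> es ! i" if "Suc i < N" for i
      using order_trans[OF es_le es_ge] that by simp
    thus "\<forall>i. Suc i < length es \<longrightarrow> es ! Suc i \<le> es ! i"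
      using len_ms by (simp add: es_def)
  qed
  have es_nonneg: "0 \<le> e" if e: "e \<in> set es" for e
  proof -
    from e obtain i where "i < length es" "e = es ! i" by (auto simp: in_set_conv_nth)
    thus ?thesis
      using es_ge[of i] nonneg[of "xs ! Suc i"] len len_ms
      by (cases "i = length ms") (auto simp: es_def intro: order_trans)
  qed
  have A: "A \<in> carrier_mat N N" unfolding A_def
    using x_dim by (intro minus_carrier_mat) (auto simp: outer_prod_def)
  have "transpose_mat A = A"
    by (rule eq_matI) (use x_dim in \<open>auto simp: A_def outer_prod_def mat_diag_def mult.commute\<close>)
  hence "singular_values A = mset es"
    using singular_values_symmetric[OF A _ char es_nonneg] by simp
  hence sv: "singular_value A k = es ! (k - 1)" for k
    by (simp add: singular_value_def kth_largest_mset[OF sorted_es])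
  have g_le: "xs ! i * (1 - xs ! i + xs ! Suc i) \<le> xs ! i" if "Suc i < N" for i
    using mono[of i "Suc i"] nonneg[of "xs ! i"] that len by (intro mult_left_le) auto
  have g_ge: "es ! i \<le> xs ! i * (1 - xs ! i + xs ! Suc i)" if i: "Suc i < N" for i
  proof -
    define a b where "a = xs ! i" and "b = xs ! Suc i"
    have xs_eq: "xs = take i xs @ a # b # drop (Suc (Suc i)) xs"
      using i len by (simp add: a_def b_def Cons_nth_drop_Suc)
    have ab: "b \<le> a" "0 \<le> b" using mono[of i "Suc i"] nonneg[of b] i len by (auto simp: a_def b_def)
    have us: "a \<le> u" if u: "u \<in> set (take i xs)" for u
      using that mono i len by (auto simp: a_def in_set_conv_nth)
    have vs: "0 \<le> v \<and> v \<le> b" if v: "v \<in> set (drop (Suc (Suc i)) xs)" for v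
    proof
      show "0 \<le> v" using nonneg in_set_dropD[OF v] by simp
      show "v \<le> b" using v mono i len by (auto simp: b_def in_set_conv_nth)
    qed
    have m: "b \<le> es ! i" "es ! i \<le> a" "b < a \<Longrightarrow> es ! i < a"
      using ms[of i] i len_ms by (simp_all add: a_def b_def es_def nth_append)
    have "a \<le> 1"
    proof -
      have "0 \<le> sum_list (take i xs)" "0 \<le> sum_list (drop (Suc (Suc i)) xs)"
        using nonneg by (auto intro!: sum_list_nonneg dest: in_set_takeD in_set_dropD)
      moreover have "sum_list (take i xs @ a # b # drop (Suc (Suc i)) xs) = 1"
        using sum xs_eq by metis
      ultimately show ?thesis using ab by simp
    qed
    \<comment> \<open>The upper end \<open>a\<close> is attained only in a degenerate gap, where the
      bound equals \<open>a\<close>. The partial fraction argument needs \<open>es ! i\<close> to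
      avoid both poles.\<close>
    consider "es ! i = b" | "b < es ! i" "es ! i < a" | "es ! i = a" "b = a"
      using m by fastforce
    hence "es ! i \<le> a * (1 - a + b)"
    proof cases
      case 1
      \<comment> \<open>This product is exactly \<open>a * (1 - a + b) - b\<close>.\<close>
      have "0 \<le> (a - b) * (1 - a)" using ab \<open>a \<le> 1\<close> by simp
      with 1 show ?thesis by (simp add: algebra_simps)
    next
      case 2
      have "poly (pole_numerator zs) (es ! i) = 0"
        using i len_ms by (auto simp: num poly_root_poly prod_list_zero_iff es_def nth_append)
      with 2 us vs ab sum show ?thesis
        by (intro pole_numerator_root_bound[of "take i xs" a "drop (Suc (Suc i)) xs" b "es ! i"])
          (auto simp: zs_def simp flip: xs_eq)
    next
      case 3
      thus ?thesis by simp
    qed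
    thus ?thesis by (simp add: a_def b_def)
  qed
  show ?thesis
  proof
    fix k assume "k \<in> {1..N}"
    then obtain i where k: "k = Suc i" "i < N" by (cases k) auto
    show "ranked_entry x k \<ge> g_fun k x \<and> g_fun k x \<ge> singular_value A k
        \<and> (k < N \<longrightarrow> singular_value A k \<ge> ranked_entry x (k + 1))"
    proof (cases "k < N")
      case True
      thus ?thesis using g_le[of i] g_ge[of i] es_ge[of i] k x_dim
        by (simp add: rank sv g_fun_def)
    next
      case False
      \<comment> \<open>For \<open>k = N\<close> both \<open>g_fun k x\<close> and the last element
        of \<open>es\<close> are 0.\<close>
      hence "i = length ms" using k len_ms by simp
      thus ?thesis using False k nonneg[of "xs ! i"] len x_dim
        by (simp add: rank sv g_fun_def es_def)
    qed
  qed
qed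

end
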